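(* Let $(\Omega,\sigma)$ be a subshift of finite type described by an $n\times n$ transition matrix $M$ with entries in $\{0,1\}$, and let $\overline{\sigma}$ be the induced map on the hyperspace $\mathcal{K}(\Omega)$ of nonempty compact subsets of $\Omega$. The following are equivalent: 1. $(\Omega,\sigma)$ is weakly mixing. 2. $(\mathcal{K}(\Omega),\overline{\sigma})$ is weakly mixing. 3. $(\mathcal{K}(\Omega),\overline{\sigma})$ is transitive.
   Context: For a $\{0,1\}$-matrix $M=(m_{ij})_{1\le i,j\le n}$, the subshift of finite type is $\Omega=\Sigma_M=\{(x_i)_{i\ge 0}\in\{1,\dots,n\}^{\mathbb{N}}: m_{x_ix_{i+1}}=1 \text{ for all } i\ge 0\}$, with $\sigma(x_0x_1x_2\ldots)=x_1x_2x_3\ldots$ and metric $D(\bar x,\bar y)=\sum_{i=0}^\infty\frac{\delta(x_i,y_i)}{2^i}$, $\delta$ the discrete metric. $\mathcal{K}(\Omega)$ carries the Hausdorff metric induced by $D$ (equivalently the Vietoris topology), and $\overline{\sigma}(K)=\sigma(K)$. A continuous $f:X\to X$ is transitive if for any nonempty open $U,V\subseteq X$ there is a positive integer $n$ with $f^n(U)\cap V\neq\emptyset$; it is weakly mixing if $f\times f$ is transitive on $X\times X$. *)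

theory Defs
  imports "HOL-Analysis.Analysis"
begin

definition transitive_map :: "'a topology \<Rightarrow> ('a \<Rightarrow> 'a) \<Rightarrow> bool" where
  "transitive_map X f \<longleftrightarrow> continuous_map X X f \<and>
     (\<forall>U V. openin X U \<and> U \<noteq> {} \<and> openin X V \<and> V \<noteq> {} \<longrightarrow>
        (\<exists>n>0. (f ^^ n) ` U \<inter> V \<noteq> {}))"

definition weakly_mixing :: "'a topology \<Rightarrow> ('a \<Rightarrow> 'a) \<Rightarrow> bool" where
  "weakly_mixing X f \<longleftrightarrow> continuous_map X X f \<and>
     transitive_map (prod_topology X X) (map_prod f f)"

definition hyperspace :: "'a set \<Rightarrow> ('a \<Rightarrow> 'a \<Rightarrow> real) \<Rightarrow> 'a set set" where
  "hyperspace S d = {K. K \<noteq> {} \<and> compactin (Metric_space.mtopology S d) K}"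

text \<open>The value \<open>0\<close> off the hyperspace is irrelevant to the topology; it is there because
  \<^locale>\<open>Metric_space\<close> requires a distance to be nonnegative and symmetric on the whole type.\<close>

definition hausdorff_dist :: "'a set \<Rightarrow> ('a \<Rightarrow> 'a \<Rightarrow> real) \<Rightarrow> 'a set \<Rightarrow> 'a set \<Rightarrow> real" where
  "hausdorff_dist S d A B =
     (if A \<in> hyperspace S d \<and> B \<in> hyperspace S d
      then max (SUP a\<in>A. INF b\<in>B. d a b) (SUP b\<in>B. INF a\<in>A. d a b)
      else 0)"

definition hyperspace_topology :: "'a set \<Rightarrow> ('a \<Rightarrow> 'a \<Rightarrow> real) \<Rightarrow> 'a set topology" where
  "hyperspace_topology S d = Metric_space.mtopology (hyperspace S d) (hausdorff_dist S d)"

context Metric_space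
begin

lemma hyperspaceD:
  assumes "K \<in> hyperspace M d"
  shows "K \<noteq> {}" "K \<subseteq> M" "closedin mtopology K" "\<exists>B. \<forall>x\<in>K. \<forall>y\<in>K. d x y \<le> B"
proof -
  have c: "compactin mtopology K" and ne: "K \<noteq> {}"
    using assms by (auto simp: hyperspace_def)
  show "K \<noteq> {}" by (fact ne)
  show "K \<subseteq> M" using c compactin_subset_topspace by fastforce
  show "closedin mtopology K"
    using c compactin_imp_closedin Hausdorff_space_mtopology by blast
  show "\<exists>B. \<forall>x\<in>K. \<forall>y\<in>K. d x y \<le> B"
    using compactin_imp_mbounded[OF c] by (auto simp: mbounded_alt)
qed

lemma bdd_below_dist: "bdd_below (d x ` B)"
  by (rule bdd_belowI[of _ 0]) auto

lemma INF_dist_nonneg: "B \<noteq> {} \<Longrightarrow> 0 \<le> (INF b\<in>B. d x b)"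
  by (rule cINF_greatest) auto

lemma bdd_above_INF_dist:
  assumes "A \<in> hyperspace M d" "B \<in> hyperspace M d"
  shows "bdd_above ((\<lambda>a. INF b\<in>B. d a b) ` A)"
proof -
  obtain a0 b0 where ab: "a0 \<in> A" "b0 \<in> B" using hyperspaceD(1) assms by blast
  obtain C where C: "\<forall>x\<in>A. \<forall>y\<in>A. d x y \<le> C" using hyperspaceD(4) assms(1) by blast
  have "(INF b\<in>B. d a b) \<le> C + d a0 b0" if "a \<in> A" for a
  proof -
    have "(INF b\<in>B. d a b) \<le> d a b0" using ab bdd_below_dist by (intro cINF_lower) auto
    also have "\<dots> \<le> d a a0 + d a0 b0"
      using triangle that ab hyperspaceD(2) assms by (meson subsetD)
    also have "\<dots> \<le> C + d a0 b0" using C that ab by simp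
    finally show ?thesis .
  qed
  then show ?thesis by (intro bdd_aboveI2) auto
qed

lemma hausdorff_excess_triangle:
  assumes A: "A \<in> hyperspace M d" and B: "B \<in> hyperspace M d" and C: "C \<in> hyperspace M d"
  shows "(SUP a\<in>A. INF c\<in>C. d a c) \<le> (SUP a\<in>A. INF b\<in>B. d a b) + (SUP b\<in>B. INF c\<in>C. d b c)"
proof (rule cSUP_least)
  show "A \<noteq> {}" using A hyperspaceD by blast
next
  fix a assume a: "a \<in> A"
  have ne: "B \<noteq> {}" "C \<noteq> {}" using B C hyperspaceD by blast+
  have *: "(INF c\<in>C. d a c) - (SUP b\<in>B. INF c\<in>C. d b c) \<le> d a b" if b: "b \<in> B" for b
  proof -
    have "(INF c\<in>C. d a c) - d a b \<le> d b c" if c: "c \<in> C" for c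
    proof -
      have "(INF c\<in>C. d a c) \<le> d a c" using c bdd_below_dist by (intro cINF_lower) auto
      also have "\<dots> \<le> d a b + d b c"
        using triangle a b c hyperspaceD(2) A B C by (meson subsetD)
      finally show ?thesis by simp
    qed
    then have "(INF c\<in>C. d a c) - d a b \<le> (INF c\<in>C. d b c)"
      using ne by (intro cINF_greatest) auto
    also have "\<dots> \<le> (SUP b\<in>B. INF c\<in>C. d b c)"
      using b bdd_above_INF_dist[OF B C] by (intro cSUP_upper) auto
    finally show ?thesis by simp
  qed
  have "(INF c\<in>C. d a c) - (SUP b\<in>B. INF c\<in>C. d b c) \<le> (INF b\<in>B. d a b)"
    using ne * by (intro cINF_greatest) auto
  also have "\<dots> \<le> (SUP a\<in>A. INF b\<in>B. d a b)"
    using a bdd_above_INF_dist[OF A B] by (intro cSUP_upper) auto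
  finally show "(INF c\<in>C. d a c) \<le> (SUP a\<in>A. INF b\<in>B. d a b) + (SUP b\<in>B. INF c\<in>C. d b c)"
    by simp
qed

lemma hausdorff_excess_nonneg:
  assumes "A \<in> hyperspace M d" "B \<in> hyperspace M d"
  shows "0 \<le> (SUP a\<in>A. INF b\<in>B. d a b)"
proof -
  obtain a where a: "a \<in> A" using hyperspaceD(1) assms by blast
  have "0 \<le> (INF b\<in>B. d a b)" using hyperspaceD(1) assms INF_dist_nonneg by blast
  also have "\<dots> \<le> (SUP a\<in>A. INF b\<in>B. d a b)"
    using a bdd_above_INF_dist[OF assms] by (intro cSUP_upper) auto
  finally show ?thesis .
qed

lemma hausdorff_excess_zero:
  assumes A: "A \<in> hyperspace M d" and B: "B \<in> hyperspace M d"
    and le: "(SUP a\<in>A. INF b\<in>B. d a b) \<le> 0"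
  shows "A \<subseteq> B"
proof
  fix a assume a: "a \<in> A"
  have aM: "a \<in> M" using a A hyperspaceD(2) by blast
  have neB: "B \<noteq> {}" using B hyperspaceD by blast
  have "(INF b\<in>B. d a b) \<le> (SUP a\<in>A. INF b\<in>B. d a b)"
    using a bdd_above_INF_dist[OF A B] by (intro cSUP_upper) auto
  with le have 0: "(INF b\<in>B. d a b) \<le> 0" by simp
  have "\<exists>b\<in>B. b \<in> mball a r" if "r > 0" for r
  proof -
    have "(INF b\<in>B. d a b) < r" using 0 that by simp
    then obtain b where "b \<in> B" "d a b < r"
      using cINF_less_iff[OF neB bdd_below_dist] by blast
    then show ?thesis using aM hyperspaceD(2)[OF B] by auto
  qed
  then have "a \<in> mtopology closure_of B"
    using aM by (auto simp: metric_closure_of)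
  then show "a \<in> B"
    using hyperspaceD(3)[OF B] closure_of_eq by metis
qed

lemma hausdorff_dist_eq:
  assumes "A \<in> hyperspace M d" "B \<in> hyperspace M d"
  shows "hausdorff_dist M d A B =
    max (SUP a\<in>A. INF b\<in>B. d a b) (SUP b\<in>B. INF a\<in>A. d b a)"
  using assms by (simp add: hausdorff_dist_def commute)

lemma Metric_space_hausdorff: "Metric_space (hyperspace M d) (hausdorff_dist M d)"
proof
  fix A B
  show "0 \<le> hausdorff_dist M d A B"
    using hausdorff_excess_nonneg by (auto simp: hausdorff_dist_def le_max_iff_disj)
  show "hausdorff_dist M d A B = hausdorff_dist M d B A"
    by (simp add: hausdorff_dist_def commute max.commute)
next
  fix A B assume A: "A \<in> hyperspace M d" and B: "B \<in> hyperspace M d"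
  show "hausdorff_dist M d A B = 0 \<longleftrightarrow> A = B"
  proof
    assume "hausdorff_dist M d A B = 0"
    then show "A = B"
      using hausdorff_excess_zero A B by (simp add: hausdorff_dist_eq) (metis max.cobounded1 max.cobounded2 subset_antisym)
  next
    assume eq: "A = B"
    have "(INF b\<in>A. d a b) \<le> 0" if "a \<in> A" for a
      using cINF_lower[OF bdd_below_dist that, of a] hyperspaceD(2)[OF A] that by auto
    then have "(SUP a\<in>A. INF b\<in>A. d a b) \<le> 0"
      using hyperspaceD(1)[OF A] by (intro cSUP_least) auto
    then show "hausdorff_dist M d A B = 0"
      using eq A hausdorff_excess_nonneg[OF A A] by (simp add: hausdorff_dist_eq)
  qed
next
  fix A B C
  assume "A \<in> hyperspace M d" "B \<in> hyperspace M d" "C \<in> hyperspace M d"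
  then show "hausdorff_dist M d A C \<le> hausdorff_dist M d A B + hausdorff_dist M d B C"
    using hausdorff_excess_triangle[of A B C] hausdorff_excess_triangle[of C B A]
    by (simp add: hausdorff_dist_eq max_def)
qed

end

text \<open>The \<open>n\<close>-letter alphabet \<open>{1, \<dots>, n}\<close> is the finite index type of the matrix.\<close>

definition subshift :: "nat ^ 'n ^ 'n \<Rightarrow> (nat \<Rightarrow> 'n) set" where
  "subshift M = {x. \<forall>i. M $ x i $ x (Suc i) = 1}"

definition shift :: "(nat \<Rightarrow> 'n) \<Rightarrow> nat \<Rightarrow> 'n" where
  "shift x = (\<lambda>i. x (Suc i))"

definition seq_dist :: "(nat \<Rightarrow> 'n) \<Rightarrow> (nat \<Rightarrow> 'n) \<Rightarrow> real" where
  "seq_dist x y = (\<Sum>i. discrete_metric.dd (x i) (y i) / 2 ^ i)"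

lemma summable_seq_dist: "summable (\<lambda>i. discrete_metric.dd (x i) (y i) / 2 ^ i)"
proof (rule summable_comparison_test')
  show "summable (\<lambda>i. (1/2::real) ^ i)" by (rule summable_geometric) simp
  show "norm (discrete_metric.dd (x i) (y i) / 2 ^ i) \<le> (1/2) ^ i" if "i \<ge> 0" for i
    by (simp add: discrete_metric.dd_def power_divide)
qed

lemma Metric_space_seq_dist: "Metric_space S seq_dist"
proof
  fix x y :: "nat \<Rightarrow> 'a"
  show "0 \<le> seq_dist x y"
    unfolding seq_dist_def by (intro suminf_nonneg summable_seq_dist) (simp add: discrete_metric.dd_def)
  show "seq_dist x y = seq_dist y x"
    by (simp add: seq_dist_def discrete_metric.dd_def eq_commute)
  show "seq_dist x y = 0 \<longleftrightarrow> x = y"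
    unfolding seq_dist_def
    by (subst suminf_eq_zero_iff[OF summable_seq_dist]) (auto simp: discrete_metric.dd_def fun_eq_iff)
next
  fix x y z :: "nat \<Rightarrow> 'a"
  show "seq_dist x z \<le> seq_dist x y + seq_dist y z"
    unfolding seq_dist_def suminf_add[OF summable_seq_dist summable_seq_dist]
    by (intro suminf_le summable_add summable_seq_dist)
       (auto simp: discrete_metric.dd_def)
qed

definition subshift_topology :: "nat ^ 'n ^ 'n \<Rightarrow> (nat \<Rightarrow> 'n) topology" where
  "subshift_topology M = Metric_space.mtopology (subshift M) seq_dist"

end

(* Write N(U,V) for the set of times n > 0 with f^n(U) meeting V.

   If f is weakly mixing, then the sets N(U,V) form a filter base (Furstenberg): for k in
   N(U1,U2) and N(V1,V2), N(U1 \<inter> f^{-k} U2, V1 \<inter> f^{-k} V2) lies in N(U1,V1) and in N(U2,V2).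
   Hence finitely many balls can be moved simultaneously to finitely many balls, and replacing
   compact sets by finite nets gives weak mixing of the hyperspace.

   Conversely, transitivity of the hyperspace, applied to {K. K \<subseteq> U} and
   {K. K meets V1 and V2}, shows that N(U,V1) and N(U,V2) always meet. Taking
   U = U1 \<inter> f^{-n} U2 with n in N(U1,U2), and V1, f^{-n} V2 as targets, gives weak mixing of f. *)

theory Submission
  imports Defs
begin

section \<open>Hitting times, and weak mixing expressed through them\<close>

definition hitting_times :: "('a \<Rightarrow> 'a) \<Rightarrow> 'a set \<Rightarrow> 'a set \<Rightarrow> nat set" where
  "hitting_times f U V = {n. n > 0 \<and> (f ^^ n) ` U \<inter> V \<noteq> {}}"

lemma mem_hitting_times:
  "n \<in> hitting_times f U V \<longleftrightarrow> n > 0 \<and> (\<exists>x\<in>U. (f ^^ n) x \<in> V)"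
  by (auto simp: hitting_times_def)

lemma transitive_map_hitting_times:
  "transitive_map X f \<longleftrightarrow> continuous_map X X f \<and>
     (\<forall>U V. openin X U \<and> U \<noteq> {} \<and> openin X V \<and> V \<noteq> {} \<longrightarrow> hitting_times f U V \<noteq> {})"
  unfolding transitive_map_def hitting_times_def by blast

lemma continuous_map_funpow:
  "continuous_map X X f \<Longrightarrow> continuous_map X X (f ^^ n)"
proof (induction n)
  case 0
  then show ?case by (simp add: id_def)
next
  case (Suc n)
  then show ?case using continuous_map_compose[of X X "f ^^ n" X f] by (simp add: comp_def)
qed

lemma map_prod_funpow:
  fixes f :: "'a \<Rightarrow> 'a" and g :: "'b \<Rightarrow> 'b"
  shows "map_prod f g ^^ n = map_prod (f ^^ n) (g ^^ n)"
  by (induction n) (auto simp: fun_eq_iff)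

lemma image_funpow:
  fixes f :: "'a \<Rightarrow> 'a"
  shows "image f ^^ n = image (f ^^ n)"
  by (induction n) (auto simp: fun_eq_iff)

lemma hitting_times_Times:
  "hitting_times (map_prod f f) (U1 \<times> U2) (V1 \<times> V2) = hitting_times f U1 V1 \<inter> hitting_times f U2 V2"
  by (fastforce simp: mem_hitting_times map_prod_funpow)

lemma hitting_times_mono:
  "U \<subseteq> U' \<Longrightarrow> V \<subseteq> V' \<Longrightarrow> hitting_times f U V \<subseteq> hitting_times f U' V'"
  by (fastforce simp: mem_hitting_times)

lemma continuous_map_map_prod:
  assumes "continuous_map X X f"
  shows "continuous_map (prod_topology X X) (prod_topology X X) (map_prod f f)"
  using assms
  by (simp add: map_prod_def continuous_map_prod_top)

text \<open>Every nonempty open subset of the product contains a nonempty open box, so transitivity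
  of \<open>map_prod f f\<close> can be tested on boxes. There the iterates act coordinatewise, and
  hitting a box means hitting in both coordinates at the same time.\<close>

lemma weakly_mixing_hitting_times:
  "weakly_mixing X f \<longleftrightarrow> continuous_map X X f \<and>
     (\<forall>U1 U2 V1 V2. openin X U1 \<and> U1 \<noteq> {} \<and> openin X U2 \<and> U2 \<noteq> {} \<and>
        openin X V1 \<and> V1 \<noteq> {} \<and> openin X V2 \<and> V2 \<noteq> {} \<longrightarrow>
        hitting_times f U1 V1 \<inter> hitting_times f U2 V2 \<noteq> {})"
  (is "_ \<longleftrightarrow> _ \<and> ?R")
proof -
  have "?R" if T: "transitive_map (prod_topology X X) (map_prod f f)"
  proof (intro allI impI, elim conjE)
    fix U1 U2 V1 V2
    assume "openin X U1" "U1 \<noteq> {}" "openin X U2" "U2 \<noteq> {}"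
      "openin X V1" "V1 \<noteq> {}" "openin X V2" "V2 \<noteq> {}"
    then have "hitting_times (map_prod f f) (U1 \<times> U2) (V1 \<times> V2) \<noteq> {}"
      using T unfolding transitive_map_hitting_times
      by (metis openin_prod_Times_iff Times_empty)
    then show "hitting_times f U1 V1 \<inter> hitting_times f U2 V2 \<noteq> {}"
      by (simp add: hitting_times_Times)
  qed
  moreover have "transitive_map (prod_topology X X) (map_prod f f)"
    if c: "continuous_map X X f" and R: ?R
    unfolding transitive_map_hitting_times
  proof (intro conjI allI impI, rule continuous_map_map_prod[OF c], elim conjE)
    fix U V
    assume o: "openin (prod_topology X X) U" "U \<noteq> {}" "openin (prod_topology X X) V" "V \<noteq> {}"
    obtain U1 U2 where U: "openin X U1" "openin X U2" "U1 \<noteq> {}" "U2 \<noteq> {}" "U1 \<times> U2 \<subseteq> U"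
      using o(1,2) unfolding openin_prod_topology_alt by (metis empty_iff ex_in_conv surj_pair)
    obtain V1 V2 where V: "openin X V1" "openin X V2" "V1 \<noteq> {}" "V2 \<noteq> {}" "V1 \<times> V2 \<subseteq> V"
      using o(3,4) unfolding openin_prod_topology_alt by (metis empty_iff ex_in_conv surj_pair)
    have "hitting_times f U1 V1 \<inter> hitting_times f U2 V2 \<noteq> {}"
      using R U V by blast
    then show "hitting_times (map_prod f f) U V \<noteq> {}"
      using hitting_times_mono[OF U(5) V(5), of "map_prod f f"] by (auto simp: hitting_times_Times)
  qed
  ultimately show ?thesis
    unfolding weakly_mixing_def by blast
qed

section \<open>Furstenberg's filter base of hitting times, and a criterion for weak mixing\<close>

lemma weakly_mixing_imp_transitive_map:
  "weakly_mixing X f \<Longrightarrow> transitive_map X f"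
  unfolding weakly_mixing_hitting_times transitive_map_hitting_times by blast

lemma openin_Int_vimage_funpow:
  assumes "continuous_map X X f" "openin X U" "openin X V"
  shows "openin X {x \<in> U. (f ^^ n) x \<in> V}"
proof -
  have "{x \<in> U. (f ^^ n) x \<in> V} = U \<inter> {x \<in> topspace X. (f ^^ n) x \<in> V}"
    using openin_subset[OF assms(2)] by auto
  then show ?thesis
    using openin_continuous_map_preimage[OF continuous_map_funpow[OF assms(1)] assms(3)] assms(2)
    by auto
qed

lemma weakly_mixing_hitting_times_base:
  assumes wm: "weakly_mixing X f"
    and o: "openin X U1" "U1 \<noteq> {}" "openin X V1" "V1 \<noteq> {}"
      "openin X U2" "U2 \<noteq> {}" "openin X V2" "V2 \<noteq> {}"
  obtains U V where "openin X U" "U \<noteq> {}" "openin X V" "V \<noteq> {}"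
    "hitting_times f U V \<subseteq> hitting_times f U1 V1 \<inter> hitting_times f U2 V2"
proof -
  have c: "continuous_map X X f"
    using wm by (simp add: weakly_mixing_def)
  \<comment> \<open>Weak mixing is applied crosswise: one \<open>k\<close> moves the first source to
    the second source and the first target to the second target.\<close>
  obtain k where k: "k \<in> hitting_times f U1 U2" "k \<in> hitting_times f V1 V2"
    using wm o unfolding weakly_mixing_hitting_times by (metis disjoint_iff)
  let ?U = "{x \<in> U1. (f ^^ k) x \<in> U2}" and ?V = "{x \<in> V1. (f ^^ k) x \<in> V2}"
  show thesis
  proof (rule that[of ?U ?V])
    show "openin X ?U" "openin X ?V"
      using openin_Int_vimage_funpow[OF c] o by auto
    show "?U \<noteq> {}" "?V \<noteq> {}"
      using k by (auto simp: mem_hitting_times)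
    show "hitting_times f ?U ?V \<subseteq> hitting_times f U1 V1 \<inter> hitting_times f U2 V2"
    proof
      fix n assume "n \<in> hitting_times f ?U ?V"
      then obtain x where x: "n > 0" "x \<in> U1" "(f ^^ k) x \<in> U2" "(f ^^ n) x \<in> V1"
        "(f ^^ k) ((f ^^ n) x) \<in> V2"
        by (auto simp: mem_hitting_times)
      \<comment> \<open>Commuting iterates let one orbit serve both pairs: \<open>x\<close> travels
        from \<open>U1\<close> to \<open>V1\<close> in time \<open>n\<close>, and
        \<open>(f ^^ k) x\<close> travels from \<open>U2\<close> to \<open>V2\<close>.\<close>
      have "(f ^^ k) ((f ^^ n) x) = (f ^^ n) ((f ^^ k) x)"
        by (metis add.commute comp_apply funpow_add)
      with x show "n \<in> hitting_times f U1 V1 \<inter> hitting_times f U2 V2"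
        by (auto simp: mem_hitting_times)
    qed
  qed
qed

text \<open>Induction over \<open>P\<close> with the filter base property yields a single pair of
  open sets whose hitting times lie in those of every member of \<open>P\<close>; transitivity makes
  that set nonempty. For empty \<open>P\<close> the whole space serves as both source and target,
  which is where \<open>topspace X\<close> being nonempty enters.\<close>

lemma weakly_mixing_finite_hitting_times:
  assumes wm: "weakly_mixing X f" and "finite P"
    and "\<And>U V. (U, V) \<in> P \<Longrightarrow> openin X U \<and> U \<noteq> {} \<and> openin X V \<and> V \<noteq> {}"
    and ne: "topspace X \<noteq> {}"
  obtains n where "n > 0" "\<And>U V. (U, V) \<in> P \<Longrightarrow> n \<in> hitting_times f U V"
proof -
  have "\<exists>U V. openin X U \<and> U \<noteq> {} \<and> openin X V \<and> V \<noteq> {} \<and>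
      (\<forall>(A, B)\<in>P. hitting_times f U V \<subseteq> hitting_times f A B)"
    using assms(2,3)
  proof (induction P rule: finite_induct)
    case empty
    then show ?case using ne openin_topspace by blast
  next
    case (insert p P)
    obtain A B where p: "p = (A, B)" by fastforce
    obtain U V where UV: "openin X U" "U \<noteq> {}" "openin X V" "V \<noteq> {}"
      "\<forall>(A, B)\<in>P. hitting_times f U V \<subseteq> hitting_times f A B"
      using insert by (metis insertCI)
    have AB: "openin X A" "A \<noteq> {}" "openin X B" "B \<noteq> {}"
      using insert.prems p by auto
    obtain U' V' where UV': "openin X U'" "U' \<noteq> {}" "openin X V'" "V' \<noteq> {}"
      "hitting_times f U' V' \<subseteq> hitting_times f A B \<inter> hitting_times f U V"
      by (rule weakly_mixing_hitting_times_base[OF wm AB UV(1-4)])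
    then show ?case
      using UV(5) p by (intro exI[of _ U'] exI[of _ V']) fastforce
  qed
  then obtain U V where UV: "openin X U" "U \<noteq> {}" "openin X V" "V \<noteq> {}"
    "\<forall>(A, B)\<in>P. hitting_times f U V \<subseteq> hitting_times f A B"
    by blast
  then have "hitting_times f U V \<noteq> {}"
    using weakly_mixing_imp_transitive_map[OF wm] by (simp add: transitive_map_hitting_times)
  then obtain n where "n \<in> hitting_times f U V"
    by blast
  then have "n \<in> hitting_times f A B" if "(A, B) \<in> P" for A B
    using UV(5) that by blast
  moreover have "n > 0"
    using \<open>n \<in> hitting_times f U V\<close> by (simp add: mem_hitting_times)
  ultimately show thesis
    using that by blast
qed

text \<open>A substitute for surjectivity: it lets the pullback of an open target under an iterate
  serve again as a nonempty open target.\<close>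

lemma transitive_map_vimage_funpow_nonempty:
  assumes t: "transitive_map X f" and "openin X V" "V \<noteq> {}"
  shows "{x \<in> topspace X. (f ^^ n) x \<in> V} \<noteq> {}"
proof (induction n)
  case 0
  then show ?case using assms openin_subset by fastforce
next
  case (Suc n)
  let ?W = "{x \<in> topspace X. (f ^^ n) x \<in> V}"
  have c: "continuous_map X X f" using t by (simp add: transitive_map_def)
  have "openin X ?W"
    using openin_Int_vimage_funpow[OF c openin_topspace assms(2)] .
  then have "hitting_times f (topspace X) ?W \<noteq> {}"
    using t Suc by (auto simp: transitive_map_hitting_times)
  then obtain k x where k: "k > 0" "x \<in> topspace X" "(f ^^ k) x \<in> ?W"
    unfolding ex_in_conv[symmetric] mem_hitting_times by blast
  \<comment> \<open>Times are positive, so the last application of \<open>f\<close> can be split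
    off: \<open>(f ^^ j) x\<close> is a point that \<open>f\<close> sends into
    \<open>?W\<close>.\<close>
  obtain j where "k = Suc j" using k(1) gr0_implies_Suc by blast
  moreover have "(f ^^ j) x \<in> topspace X"
    using continuous_map_funpow[OF c] k(2) continuous_map_image_subset_topspace by blast
  ultimately have "(f ^^ j) x \<in> {x \<in> topspace X. (f ^^ Suc n) x \<in> V}"
    using k(3) by (simp add: funpow_swap1)
  then show ?case by blast
qed

text \<open>Two sources are merged into one by pulling \<open>U2\<close> back into \<open>U1\<close>
  along a hitting time \<open>n\<close>; pulling \<open>V2\<close> back along the same
  \<open>n\<close> compensates for this in the second target.\<close>

lemma weakly_mixing_if_common_source:
  assumes c: "continuous_map X X f"
    and meet: "\<And>U V1 V2. \<lbrakk>openin X U; U \<noteq> {}; openin X V1; V1 \<noteq> {}; openin X V2; V2 \<noteq> {}\<rbrakk>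
      \<Longrightarrow> hitting_times f U V1 \<inter> hitting_times f U V2 \<noteq> {}"
  shows "weakly_mixing X f"
  unfolding weakly_mixing_hitting_times
proof (intro conjI allI impI, rule c, elim conjE)
  have t: "transitive_map X f"
    using c meet unfolding transitive_map_hitting_times by blast
  fix U1 U2 V1 V2
  assume o: "openin X U1" "U1 \<noteq> {}" "openin X U2" "U2 \<noteq> {}"
    "openin X V1" "V1 \<noteq> {}" "openin X V2" "V2 \<noteq> {}"
  obtain n where n: "n \<in> hitting_times f U1 U2"
    using t o unfolding transitive_map_hitting_times by (metis ex_in_conv)
  let ?W = "{x \<in> U1. (f ^^ n) x \<in> U2}" and ?V = "{x \<in> topspace X. (f ^^ n) x \<in> V2}"
  have "hitting_times f ?W V1 \<inter> hitting_times f ?W ?V \<noteq> {}"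
  proof (rule meet)
    show "openin X ?W" "openin X ?V"
      using openin_Int_vimage_funpow[OF c] o openin_topspace by blast+
    show "?W \<noteq> {}" using n by (auto simp: mem_hitting_times)
    show "?V \<noteq> {}" using transitive_map_vimage_funpow_nonempty[OF t] o by blast
  qed (use o in auto)
  \<comment> \<open>Both \<open>x\<close> and \<open>y\<close> start in \<open>?W\<close> but may
    differ. The first pair is witnessed by \<open>x\<close>, the second by
    \<open>(f ^^ n) y\<close>, which lies in \<open>U2\<close>.\<close>
  then obtain m x y where m: "m > 0" "x \<in> U1" "(f ^^ m) x \<in> V1"
    "(f ^^ n) y \<in> U2" "(f ^^ n) ((f ^^ m) y) \<in> V2"
    by (auto simp: mem_hitting_times)
  moreover have "(f ^^ n) ((f ^^ m) y) = (f ^^ m) ((f ^^ n) y)"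
    by (metis add.commute comp_apply funpow_add)
  ultimately have "m \<in> hitting_times f U1 V1 \<inter> hitting_times f U2 V2"
    by (auto simp: mem_hitting_times)
  then show "hitting_times f U1 V1 \<inter> hitting_times f U2 V2 \<noteq> {}"
    by blast
qed

section \<open>The Hausdorff distance: estimates, Vietoris open sets and continuity of the induced
  map\<close>

context Metric_space
begin

text \<open>The infimum over \<open>B\<close> lies strictly below \<open>e\<close>, so an actual
  point of \<open>B\<close> undercuts \<open>e\<close>.\<close>

lemma hausdorff_dist_lessD:
  assumes A: "A \<in> hyperspace M d" and B: "B \<in> hyperspace M d"
    and less: "hausdorff_dist M d A B < e" and a: "a \<in> A"
  obtains b where "b \<in> B" "d a b < e"
proof -
  have "(INF b\<in>B. d a b) \<le> (SUP a\<in>A. INF b\<in>B. d a b)"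
    using a bdd_above_INF_dist[OF A B] by (intro cSUP_upper) auto
  also have "\<dots> < e"
    using less by (simp add: hausdorff_dist_eq[OF A B])
  finally show thesis
    using cINF_less_iff[OF hyperspaceD(1)[OF B] bdd_below_dist] that by blast
qed

lemma hausdorff_dist_lessD':
  assumes "A \<in> hyperspace M d" "B \<in> hyperspace M d"
    and "hausdorff_dist M d A B < e" "b \<in> B"
  obtains a where "a \<in> A" "d a b < e"
  using hausdorff_dist_lessD[OF assms(2,1) _ assms(4), of e] assms(3)
  by (metis Metric_space.commute[OF Metric_space_hausdorff] commute)

lemma hausdorff_excess_le:
  assumes A: "A \<in> hyperspace M d"
    and "\<And>a. a \<in> A \<Longrightarrow> \<exists>b\<in>B. d a b \<le> e"
  shows "(SUP a\<in>A. INF b\<in>B. d a b) \<le> e"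
proof (rule cSUP_least[OF hyperspaceD(1)[OF A]])
  fix a assume "a \<in> A"
  then obtain b where "b \<in> B" "d a b \<le> e" using assms(2) by blast
  then show "(INF b\<in>B. d a b) \<le> e"
    using cINF_lower[OF bdd_below_dist] by (meson order_trans)
qed

text \<open>The bound is non-strict, since a supremum of values below \<open>e\<close> may equal
  \<open>e\<close>. Strict bounds are obtained later by leaving slack: \<open>e/2\<close> against
  \<open>e\<close>, and \<open>2 * e\<close> against \<open>3 * e\<close>.\<close>

lemma hausdorff_dist_leI:
  assumes "A \<in> hyperspace M d" "B \<in> hyperspace M d"
    and "\<And>a. a \<in> A \<Longrightarrow> \<exists>b\<in>B. d a b \<le> e" "\<And>b. b \<in> B \<Longrightarrow> \<exists>a\<in>A. d a b \<le> e"
  shows "hausdorff_dist M d A B \<le> e"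
proof -
  have "(SUP a\<in>A. INF b\<in>B. d a b) \<le> e" "(SUP b\<in>B. INF a\<in>A. d b a) \<le> e"
    using assms by (auto intro!: hausdorff_excess_le simp: commute)
  then show ?thesis
    by (simp add: hausdorff_dist_eq assms(1,2))
qed

lemma finite_mem_hyperspace:
  "finite F \<Longrightarrow> F \<noteq> {} \<Longrightarrow> F \<subseteq> M \<Longrightarrow> F \<in> hyperspace M d"
  by (simp add: hyperspace_def finite_imp_compactin)

lemma image_mem_hyperspace:
  assumes "continuous_map mtopology mtopology f" "K \<in> hyperspace M d"
  shows "f ` K \<in> hyperspace M d"
  using assms image_compactin by (fastforce simp: hyperspace_def)

lemma openin_hyperspace_topology:
  "openin (hyperspace_topology M d) \<U> \<longleftrightarrow> \<U> \<subseteq> hyperspace M d \<and>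
    (\<forall>K\<in>\<U>. \<exists>r>0. \<forall>L\<in>hyperspace M d. hausdorff_dist M d K L < r \<longrightarrow> L \<in> \<U>)"
proof -
  interpret H: Metric_space "hyperspace M d" "hausdorff_dist M d"
    by (rule Metric_space_hausdorff)
  show ?thesis
    unfolding hyperspace_topology_def H.openin_mtopology H.mball_def by blast
qed

text \<open>The upper Vietoris sets. By compactness \<open>K\<close> has a uniform distance to spare
  inside \<open>U\<close>: a Lebesgue number of the one-element cover \<open>{U}\<close>.\<close>

lemma openin_hyperspace_subset:
  assumes U: "openin mtopology U"
  shows "openin (hyperspace_topology M d) {K \<in> hyperspace M d. K \<subseteq> U}"
  unfolding openin_hyperspace_topology
proof (intro conjI ballI)
  fix K assume "K \<in> {K \<in> hyperspace M d. K \<subseteq> U}"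
  then have K: "K \<in> hyperspace M d" "K \<subseteq> U" by auto
  obtain r where r: "r > 0" "\<forall>x\<in>K. mball x r \<subseteq> U"
    using lebesgue_number[of K "{U}"] K U by (auto simp: hyperspace_def)
  show "\<exists>r>0. \<forall>L\<in>hyperspace M d. hausdorff_dist M d K L < r \<longrightarrow> L \<in> {K \<in> hyperspace M d. K \<subseteq> U}"
  proof (intro exI[of _ r] conjI r(1) ballI impI)
    fix L assume L: "L \<in> hyperspace M d" "hausdorff_dist M d K L < r"
    have "y \<in> U" if y: "y \<in> L" for y
    proof -
      obtain x where "x \<in> K" "d x y < r"
        using hausdorff_dist_lessD'[OF K(1) L(1) L(2) y] .
      then show ?thesis
        using r(2) y hyperspaceD(2)[OF K(1)] hyperspaceD(2)[OF L(1)] by (force simp: subset_iff)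
    qed
    then show "L \<in> {K \<in> hyperspace M d. K \<subseteq> U}" using L by auto
  qed
qed auto

text \<open>The lower Vietoris sets. A single point of \<open>K\<close> in \<open>U\<close> decides:
  every Hausdorff-near \<open>L\<close> has a point in a small ball around it.\<close>

lemma openin_hyperspace_meets:
  assumes U: "openin mtopology U"
  shows "openin (hyperspace_topology M d) {K \<in> hyperspace M d. K \<inter> U \<noteq> {}}"
  unfolding openin_hyperspace_topology
proof (intro conjI ballI)
  fix K assume "K \<in> {K \<in> hyperspace M d. K \<inter> U \<noteq> {}}"
  then obtain x where K: "K \<in> hyperspace M d" and x: "x \<in> K" "x \<in> U" by auto
  obtain r where r: "r > 0" "mball x r \<subseteq> U"
    using U x(2) by (auto simp: openin_mtopology)
  show "\<exists>r>0. \<forall>L\<in>hyperspace M d. hausdorff_dist M d K L < r \<longrightarrow>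
      L \<in> {K \<in> hyperspace M d. K \<inter> U \<noteq> {}}"
  proof (intro exI[of _ r] conjI r(1) ballI impI)
    fix L assume L: "L \<in> hyperspace M d" "hausdorff_dist M d K L < r"
    obtain y where y: "y \<in> L" "d x y < r"
      using hausdorff_dist_lessD[OF K L x(1)] .
    then have "y \<in> U"
      using r(2) x(1) hyperspaceD(2)[OF K] hyperspaceD(2)[OF L(1)] by (force simp: subset_iff)
    then show "L \<in> {K \<in> hyperspace M d. K \<inter> U \<noteq> {}}" using L y by auto
  qed
qed auto

text \<open>Stronger than uniform continuity on \<open>K\<close>, because \<open>y\<close> ranges
  over all of \<open>M\<close>: a set Hausdorff-near to \<open>K\<close> may leave \<open>K\<close>.
  The number \<delta> is a Lebesgue number for the cover of \<open>K\<close> by preimages of balls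
  of radius \<open>e/2\<close>.\<close>

lemma continuous_map_uniform_near_compact:
  assumes f: "continuous_map mtopology mtopology f" and K: "compactin mtopology K" and "e > 0"
  obtains \<delta> where "\<delta> > 0" "\<And>x y. \<lbrakk>x \<in> K; y \<in> M; d x y < \<delta>\<rbrakk> \<Longrightarrow> d (f x) (f y) < e"
proof -
  have fM: "f x \<in> M" if "x \<in> M" for x
    using f that continuous_map_image_subset_topspace by fastforce
  have KM: "K \<subseteq> M" using K compactin_subset_topspace by fastforce
  let ?C = "(\<lambda>c. {x \<in> M. f x \<in> mball c (e/2)}) ` M"
  have "K \<subseteq> \<Union> ?C"
  proof
    fix x assume "x \<in> K"
    then have "x \<in> {z \<in> M. f z \<in> mball (f x) (e/2)}" "f x \<in> M"
      using KM fM \<open>e > 0\<close> by auto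
    then show "x \<in> \<Union> ?C" by blast
  qed
  moreover have "openin mtopology U" if "U \<in> ?C" for U
    using that openin_continuous_map_preimage[OF f openin_mball] unfolding topspace_mtopology by blast
  ultimately obtain \<delta> where \<delta>: "\<delta> > 0" "\<forall>x\<in>K. \<exists>U\<in>?C. mball x \<delta> \<subseteq> U"
    using lebesgue_number[OF K, of ?C] by blast
  show thesis
  proof (rule that[OF \<delta>(1)])
    fix x y assume xy: "x \<in> K" "y \<in> M" "d x y < \<delta>"
    then obtain c where c: "c \<in> M" "mball x \<delta> \<subseteq> {z \<in> M. f z \<in> mball c (e/2)}"
      using \<delta>(2) by blast
    have "x \<in> mball x \<delta>" "y \<in> mball x \<delta>" using xy KM \<delta>(1) by auto
    then have "f x \<in> mball c (e/2)" "f y \<in> mball c (e/2)" using c(2) by blast+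
    then have "d c (f x) < e/2" "d c (f y) < e/2" "f x \<in> M" "f y \<in> M" by auto
    then show "d (f x) (f y) < e"
      using triangle[of "f x" c "f y"] c(1) commute[of c "f x"] by linarith
  qed
qed

lemma continuous_map_hyperspace_image:
  assumes f: "continuous_map mtopology mtopology f"
  shows "continuous_map (hyperspace_topology M d) (hyperspace_topology M d) (image f)"
proof -
  interpret H: Metric_space "hyperspace M d" "hausdorff_dist M d"
    by (rule Metric_space_hausdorff)
  show ?thesis
    unfolding hyperspace_topology_def H.metric_continuous_map[OF Metric_space_hausdorff]
  proof (intro conjI ballI allI impI)
    show "image f ` hyperspace M d \<subseteq> hyperspace M d"
      using image_mem_hyperspace[OF f] by blast
  next
    fix K and e :: real assume K: "K \<in> hyperspace M d" and e: "e > 0"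
    obtain \<delta> where \<delta>: "\<delta> > 0" "\<And>x y. \<lbrakk>x \<in> K; y \<in> M; d x y < \<delta>\<rbrakk> \<Longrightarrow> d (f x) (f y) < e/2"
      using continuous_map_uniform_near_compact[OF f, of K "e/2"] K e
      by (auto simp: hyperspace_def)
    have "hausdorff_dist M d (f ` K) (f ` L) < e"
      if L: "L \<in> hyperspace M d" "hausdorff_dist M d K L < \<delta>" for L
    proof -
      have LM: "L \<subseteq> M" using hyperspaceD(2) L by blast
      have "hausdorff_dist M d (f ` K) (f ` L) \<le> e/2"
      proof (rule hausdorff_dist_leI[OF image_mem_hyperspace[OF f K] image_mem_hyperspace[OF f L(1)]])
        fix a assume "a \<in> f ` K"
        then obtain x where x: "x \<in> K" "a = f x" by blast
        obtain y where "y \<in> L" "d x y < \<delta>" using hausdorff_dist_lessD[OF K L x(1)] .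
        then show "\<exists>b\<in>f ` L. d a b \<le> e/2" using \<delta>(2) x LM by (force intro: less_imp_le)
      next
        fix b assume "b \<in> f ` L"
        then obtain y where y: "y \<in> L" "b = f y" by blast
        obtain x where "x \<in> K" "d x y < \<delta>" using hausdorff_dist_lessD'[OF K L y(1)] .
        then show "\<exists>a\<in>f ` K. d a b \<le> e/2" using \<delta>(2) y LM by (force intro: less_imp_le)
      qed
      then show ?thesis using e by simp
    qed
    then show "\<exists>\<delta>>0. \<forall>L. L \<in> hyperspace M d \<and> hausdorff_dist M d K L < \<delta> \<longrightarrow>
        hausdorff_dist M d (f ` K) (f ` L) < e"
      using \<delta>(1) by blast
  qed
qed

section \<open>Weak mixing carried to the hyperspace by finite nets, and back\<close>

lemma hyperspace_finite_net:
  assumes K: "K \<in> hyperspace M d" and "e > 0"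
  obtains F where "finite F" "F \<noteq> {}" "F \<subseteq> K" "\<And>x. x \<in> K \<Longrightarrow> \<exists>a\<in>F. d a x < e"
proof -
  obtain F where F: "finite F" "F \<subseteq> K" "K \<subseteq> (\<Union>x\<in>F. mball x e)"
    using compactin_imp_mtotally_bounded[of K] K \<open>e > 0\<close>
    unfolding hyperspace_def mtotally_bounded_def mem_Collect_eq by metis
  moreover have "F \<noteq> {}" using F hyperspaceD(1)[OF K] by auto
  ultimately show thesis by (intro that[of F]) (auto simp: subset_iff)
qed

text \<open>\<open>K\<close> and \<open>L\<close> are compared through \<open>F\<close>. From
  \<open>K\<close> to \<open>L\<close> the path costs two steps of length below \<open>e\<close>;
  from \<open>L\<close> to \<open>K\<close> one step suffices, as \<open>F\<close> lies inside
  \<open>K\<close>. The third \<open>e\<close> makes the bound strict.\<close>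

lemma hausdorff_dist_finite_net_less:
  assumes K: "K \<in> hyperspace M d" and L: "L \<in> hyperspace M d" and "e > 0"
    and FK: "F \<subseteq> K" and net: "\<And>x. x \<in> K \<Longrightarrow> \<exists>a\<in>F. d a x < e"
    and near: "\<And>a. a \<in> F \<Longrightarrow> \<exists>z\<in>L. d a z < e" "\<And>z. z \<in> L \<Longrightarrow> \<exists>a\<in>F. d a z < e"
  shows "hausdorff_dist M d K L < 3 * e"
proof -
  have sub: "K \<subseteq> M" "L \<subseteq> M" using K L hyperspaceD(2) by blast+
  have "hausdorff_dist M d K L \<le> 2 * e"
  proof (rule hausdorff_dist_leI[OF K L])
    fix x assume x: "x \<in> K"
    obtain a where a: "a \<in> F" "d a x < e" using net x by blast
    obtain z where z: "z \<in> L" "d a z < e" using near(1) a by blast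
    have "d x z \<le> d a x + d a z"
      using triangle[of x a z] commute[of a x] sub FK x a z by auto
    then show "\<exists>z\<in>L. d x z \<le> 2 * e" using a z by force
  next
    fix z assume "z \<in> L"
    then obtain a where "a \<in> F" "d a z < e" using near(2) by blast
    then show "\<exists>x\<in>K. d x z \<le> 2 * e" using FK \<open>e > 0\<close> by force
  qed
  then show ?thesis using \<open>e > 0\<close> by linarith
qed

lemma weakly_mixing_hyperspace:
  assumes wm: "weakly_mixing mtopology f"
  shows "weakly_mixing (hyperspace_topology M d) (image f)"
proof -
  have f: "continuous_map mtopology mtopology f"
    using wm by (simp add: weakly_mixing_def)
  \<comment> \<open>Each nonempty open family is reduced to finite data: a net \<open>F\<close> and
    a radius \<open>e\<close> such that every compact set \<open>e\<close>-close to \<open>F\<close>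
    in both directions belongs to the family, as \<open>mem\<close> then records.\<close>
  have net: "\<exists>K e F. e > 0 \<and> K \<in> hyperspace M d \<and> finite F \<and> F \<noteq> {} \<and> F \<subseteq> K \<and>
      (\<forall>x\<in>K. \<exists>a\<in>F. d a x < e) \<and>
      (\<forall>L\<in>hyperspace M d. hausdorff_dist M d K L < 3 * e \<longrightarrow> L \<in> \<U>)"
    if U: "openin (hyperspace_topology M d) \<U>" "\<U> \<noteq> {}" for \<U>
  proof -
    obtain K where K: "K \<in> \<U>" using U by blast
    then have KH: "K \<in> hyperspace M d" using U unfolding openin_hyperspace_topology by blast
    obtain r where r: "r > 0" "\<forall>L\<in>hyperspace M d. hausdorff_dist M d K L < r \<longrightarrow> L \<in> \<U>"
      using U K unfolding openin_hyperspace_topology by blast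
    have "r / 3 > 0" using r by simp
    then obtain F where "finite F" "F \<noteq> {}" "F \<subseteq> K" "\<And>x. x \<in> K \<Longrightarrow> \<exists>a\<in>F. d a x < r / 3"
      using hyperspace_finite_net[OF KH] by blast
    then show ?thesis
      using KH r by (intro exI[of _ K] exI[of _ "r/3"] exI[of _ F]) auto
  qed
  have mem: "L \<in> \<U>"
    if "e > 0" "K \<in> hyperspace M d" "F \<subseteq> K" "\<forall>x\<in>K. \<exists>a\<in>F. d a x < e"
      "\<forall>L\<in>hyperspace M d. hausdorff_dist M d K L < 3 * e \<longrightarrow> L \<in> \<U>"
      "L \<in> hyperspace M d" "\<And>a. a \<in> F \<Longrightarrow> \<exists>z\<in>L. d a z < e" "\<And>z. z \<in> L \<Longrightarrow> \<exists>a\<in>F. d a z < e"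
    for \<U> K L F e
    using hausdorff_dist_finite_net_less[OF that(2,6,1,3)] that(4-8) by blast
  have "hitting_times (image f) \<U>1 \<V>1 \<inter> hitting_times (image f) \<U>2 \<V>2 \<noteq> {}"
    if o: "openin (hyperspace_topology M d) \<U>1" "\<U>1 \<noteq> {}"
    "openin (hyperspace_topology M d) \<U>2" "\<U>2 \<noteq> {}"
    "openin (hyperspace_topology M d) \<V>1" "\<V>1 \<noteq> {}"
    "openin (hyperspace_topology M d) \<V>2" "\<V>2 \<noteq> {}"
    for \<U>1 \<U>2 \<V>1 \<V>2
  proof -
    obtain K1 e1 F1 where 1: "e1 > 0" "K1 \<in> hyperspace M d" "F1 \<subseteq> K1" "\<forall>x\<in>K1. \<exists>a\<in>F1. d a x < e1"
      "\<forall>L\<in>hyperspace M d. hausdorff_dist M d K1 L < 3 * e1 \<longrightarrow> L \<in> \<U>1" "finite F1" "F1 \<noteq> {}"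
      using net[OF o(1,2)] by blast
    obtain K2 e2 F2 where 2: "e2 > 0" "K2 \<in> hyperspace M d" "F2 \<subseteq> K2" "\<forall>x\<in>K2. \<exists>a\<in>F2. d a x < e2"
      "\<forall>L\<in>hyperspace M d. hausdorff_dist M d K2 L < 3 * e2 \<longrightarrow> L \<in> \<U>2" "finite F2" "F2 \<noteq> {}"
      using net[OF o(3,4)] by blast
    obtain K3 e3 F3 where 3: "e3 > 0" "K3 \<in> hyperspace M d" "F3 \<subseteq> K3" "\<forall>x\<in>K3. \<exists>a\<in>F3. d a x < e3"
      "\<forall>L\<in>hyperspace M d. hausdorff_dist M d K3 L < 3 * e3 \<longrightarrow> L \<in> \<V>1" "finite F3" "F3 \<noteq> {}"
      using net[OF o(5,6)] by blast
    obtain K4 e4 F4 where 4: "e4 > 0" "K4 \<in> hyperspace M d" "F4 \<subseteq> K4" "\<forall>x\<in>K4. \<exists>a\<in>F4. d a x < e4"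
      "\<forall>L\<in>hyperspace M d. hausdorff_dist M d K4 L < 3 * e4 \<longrightarrow> L \<in> \<V>2" "finite F4" "F4 \<noteq> {}"
      using net[OF o(7,8)] by blast
    have FM: "F1 \<subseteq> M" "F2 \<subseteq> M" "F3 \<subseteq> M" "F4 \<subseteq> M"
      using 1(2,3) 2(2,3) 3(2,3) 4(2,3) hyperspaceD(2) by blast+
    \<comment> \<open>Every ball around a source net point is paired with every ball around a target
      net point. Taking both problems into one finite set yields one common time
      \<open>n\<close>.\<close>
    let ?P = "\<lambda>F e G e'. (\<Union>a\<in>F. \<Union>b\<in>G. {(mball a e, mball b e')})"
    obtain n where n: "n > 0"
      "\<And>U V. (U, V) \<in> ?P F1 e1 F3 e3 \<union> ?P F2 e2 F4 e4 \<Longrightarrow> n \<in> hitting_times f U V"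
    proof (rule weakly_mixing_finite_hitting_times[OF wm])
      show "finite (?P F1 e1 F3 e3 \<union> ?P F2 e2 F4 e4)"
        using 1 2 3 4 by blast
      show "openin mtopology U \<and> U \<noteq> {} \<and> openin mtopology V \<and> V \<noteq> {}"
        if "(U, V) \<in> ?P F1 e1 F3 e3 \<union> ?P F2 e2 F4 e4" for U V
        using that FM 1(1) 2(1) 3(1) 4(1) by (auto simp: mball_eq_empty)
      show "topspace mtopology \<noteq> {}"
        using FM 1(7) by auto
    qed blast
    have move: "n \<in> hitting_times (image f) \<U> \<V>"
      if F: "e > 0" "K \<in> hyperspace M d" "F \<subseteq> K" "\<forall>x\<in>K. \<exists>a\<in>F. d a x < e"
        "\<forall>L\<in>hyperspace M d. hausdorff_dist M d K L < 3 * e \<longrightarrow> L \<in> \<U>" "finite F" "F \<noteq> {}"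
      and G: "e' > 0" "K' \<in> hyperspace M d" "G \<subseteq> K'" "\<forall>x\<in>K'. \<exists>a\<in>G. d a x < e'"
        "\<forall>L\<in>hyperspace M d. hausdorff_dist M d K' L < 3 * e' \<longrightarrow> L \<in> \<V>" "finite G" "G \<noteq> {}"
      and N: "\<And>a b. a \<in> F \<Longrightarrow> b \<in> G \<Longrightarrow> n \<in> hitting_times f (mball a e) (mball b e')"
      for K F e \<U> K' G e' \<V>
    proof -
      obtain z where z: "\<And>a b. a \<in> F \<Longrightarrow> b \<in> G \<Longrightarrow> z a b \<in> mball a e \<and> (f ^^ n) (z a b) \<in> mball b e'"
        using N unfolding mem_hitting_times by metis
      \<comment> \<open>One point per pair \<open>(a, b)\<close>, near \<open>a\<close> and mapped
        near \<open>b\<close> at time \<open>n\<close>. As both nets are nonempty, each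
        \<open>a\<close> and each \<open>b\<close> occurs in some pair, so \<open>Z\<close> is close
        to \<open>F\<close> and its image close to \<open>G\<close>. Being finite, \<open>Z\<close>
        is compact.\<close>
      define Z where "Z = (\<lambda>(a, b). z a b) ` (F \<times> G)"
      have Z: "Z \<in> hyperspace M d"
      proof (rule finite_mem_hyperspace)
        show "finite Z" "Z \<noteq> {}" using F G by (auto simp: Z_def)
        show "Z \<subseteq> M" using z by (fastforce simp: Z_def)
      qed
      have "Z \<in> \<U>"
      proof (rule mem[OF F(1-5) Z])
        show "\<exists>w\<in>Z. d a w < e" if "a \<in> F" for a
        proof -
          obtain b where "b \<in> G" using G(7) by blast
          then show ?thesis using z[OF that] that by (force simp: Z_def)
        qed
        show "\<exists>a\<in>F. d a w < e" if "w \<in> Z" for w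
          using that z by (fastforce simp: Z_def)
      qed
      moreover have "(f ^^ n) ` Z \<in> \<V>"
      proof (rule mem[OF G(1-5)])
        show "(f ^^ n) ` Z \<in> hyperspace M d"
          using image_mem_hyperspace[OF continuous_map_funpow[OF f] Z] .
        show "\<exists>w\<in>(f ^^ n) ` Z. d b w < e'" if "b \<in> G" for b
        proof -
          obtain a where "a \<in> F" using F(7) by blast
          then show ?thesis using z[OF _ that] that by (force simp: Z_def)
        qed
        show "\<exists>b\<in>G. d b w < e'" if "w \<in> (f ^^ n) ` Z" for w
          using that z by (fastforce simp: Z_def)
      qed
      ultimately show ?thesis
        using n(1) by (auto simp: mem_hitting_times image_funpow)
    qed
    have "n \<in> hitting_times (image f) \<U>1 \<V>1"
      by (rule move[OF 1 3]) (use n(2) in blast)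
    moreover have "n \<in> hitting_times (image f) \<U>2 \<V>2"
      by (rule move[OF 2 4]) (use n(2) in blast)
    ultimately show ?thesis
      by blast
  qed
  then show ?thesis
    unfolding weakly_mixing_hitting_times using continuous_map_hyperspace_image[OF f] by blast
qed

text \<open>One compact set inside \<open>U\<close> whose image meets both targets contains two
  points that start in \<open>U\<close> and arrive simultaneously, which is the common-source
  criterion.\<close>

lemma transitive_hyperspace_imp_weakly_mixing:
  assumes f: "continuous_map mtopology mtopology f"
    and t: "transitive_map (hyperspace_topology M d) (image f)"
  shows "weakly_mixing mtopology f"
proof (rule weakly_mixing_if_common_source[OF f])
  fix U V1 V2
  assume o: "openin mtopology U" "U \<noteq> {}" "openin mtopology V1" "V1 \<noteq> {}"
    "openin mtopology V2" "V2 \<noteq> {}"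
  obtain u v1 v2 where uv: "u \<in> U" "v1 \<in> V1" "v2 \<in> V2" using o by blast
  then have inM: "u \<in> M" "v1 \<in> M" "v2 \<in> M" using o openin_subset by fastforce+
  let ?U = "{K \<in> hyperspace M d. K \<subseteq> U}"
    and ?V = "{K \<in> hyperspace M d. K \<inter> V1 \<noteq> {}} \<inter> {K \<in> hyperspace M d. K \<inter> V2 \<noteq> {}}"
  \<comment> \<open>A singleton and a set of at most two points show that the two Vietoris open sets
    are nonempty.\<close>
  have "{u} \<in> ?U" "{v1, v2} \<in> ?V"
    using uv inM finite_mem_hyperspace[of "{u}"] finite_mem_hyperspace[of "{v1, v2}"] by auto
  then have "?U \<noteq> {}" "?V \<noteq> {}" by blast+
  moreover have "openin (hyperspace_topology M d) ?U" "openin (hyperspace_topology M d) ?V"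
    using openin_hyperspace_subset openin_hyperspace_meets o by (auto intro!: openin_Int)
  ultimately have "hitting_times (image f) ?U ?V \<noteq> {}"
    using t unfolding transitive_map_hitting_times by blast
  then obtain n where "n \<in> hitting_times (image f) ?U ?V" by blast
  then obtain K where "n > 0" "K \<subseteq> U" "(f ^^ n) ` K \<inter> V1 \<noteq> {}" "(f ^^ n) ` K \<inter> V2 \<noteq> {}"
    unfolding mem_hitting_times image_funpow by blast
  then have "n \<in> hitting_times f U V1 \<inter> hitting_times f U V2"
    by (auto simp: mem_hitting_times)
  then show "hitting_times f U V1 \<inter> hitting_times f U V2 \<noteq> {}" by blast
qed

end

section \<open>Continuity of the shift, and the equivalences for subshifts\<close>

lemma seq_dist_shift_le: "seq_dist (shift x) (shift y) \<le> 2 * seq_dist x y"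
proof -
  let ?g = "\<lambda>i. discrete_metric.dd (x i) (y i) / 2 ^ i :: real"
  have "seq_dist x y = ?g 0 + (\<Sum>i. ?g (Suc i))"
    unfolding seq_dist_def using suminf_split_head[OF summable_seq_dist[of x y]] by simp
  moreover have "(\<Sum>i. ?g (Suc i)) = (\<Sum>i. (1/2) * (discrete_metric.dd (shift x i) (shift y i) / 2 ^ i))"
    by (simp add: shift_def)
  moreover have "\<dots> = (1/2) * seq_dist (shift x) (shift y)"
    unfolding seq_dist_def by (rule suminf_mult[OF summable_seq_dist])
  moreover have "?g 0 \<ge> 0" by (simp add: discrete_metric.dd_def)
  ultimately show ?thesis by linarith
qed

lemma continuous_map_shift:
  "continuous_map (subshift_topology M) (subshift_topology M) shift"
proof -
  interpret Metric_space "subshift M" seq_dist by (rule Metric_space_seq_dist)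
  show ?thesis
    unfolding subshift_topology_def metric_continuous_map[OF Metric_space_seq_dist]
  proof (intro conjI ballI allI impI)
    show "shift ` subshift M \<subseteq> subshift M" by (auto simp: shift_def subshift_def)
    fix a and e :: real assume "e > 0"
    then show "\<exists>\<delta>>0. \<forall>x. x \<in> subshift M \<and> seq_dist a x < \<delta> \<longrightarrow> seq_dist (shift a) (shift x) < e"
      by (intro exI[of _ "e/2"]) (auto intro: le_less_trans[OF seq_dist_shift_le])
  qed
qed

theorem mainTheorem5:
  fixes M :: "nat ^ 'n ^ 'n"
  assumes "\<forall>i j. M $ i $ j \<in> {0, 1}"
  shows "(weakly_mixing (subshift_topology M) shift
            \<longleftrightarrow> weakly_mixing (hyperspace_topology (subshift M) seq_dist) (image shift))
       \<and> (weakly_mixing (hyperspace_topology (subshift M) seq_dist) (image shift)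
            \<longleftrightarrow> transitive_map (hyperspace_topology (subshift M) seq_dist) (image shift))"
proof -
  interpret Metric_space "subshift M" seq_dist by (rule Metric_space_seq_dist)
  show ?thesis
    \<comment> \<open>The implications close a cycle: weak mixing of the shift passes to the
      hyperspace, weak mixing there gives transitivity, and transitivity there, with continuity of
      the shift, returns weak mixing of the shift.\<close>
    using weakly_mixing_hyperspace[of shift] transitive_hyperspace_imp_weakly_mixing[of shift]
      weakly_mixing_imp_transitive_map continuous_map_shift[of M]
    unfolding subshift_topology_def by blast
qed

end
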